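(* Let $r>0$, $\mathbf{x}_0\in\mathbb{R}^n$, $I=B_r(\mathbf{x}_0)\subset\mathbb{R}^n$, and let $\mathbf{F}:I\to\mathbb{R}^n$ be a map of class $C^1$ such that $\mathbf{F}(\mathbf{x}_0)=\mathbf{x}_0$ and all the eigenvalues $\lambda_1,\dots,\lambda_n$ of $D\mathbf{F}(\mathbf{x}_0)$ lie outside the unit circle, that is, $|\lambda_i|>1$ for $i=1,\dots,n$. For $\mathbf{x}_1\in B_r(\mathbf{x}_0)$ let $S(\mathbf{x}_1)=(\mathbf{x}_j)_{j\in\mathbb{N}}$ be the orbit of the discrete dynamical system generated by $\mathbf{x}_{j+1}=\mathbf{F}^{-1}(\mathbf{x}_j)$ with initial point $\mathbf{x}_1$. Then there exists $r_1<r$, $r_1>0$, such that for every $\mathbf{x}_1\in B_{r_1}(\mathbf{x}_0)$ we have $\dim_B S(\mathbf{x}_1)=0$.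
   Context: $B_r(\mathbf{x}_0)$ is the open ball of radius $r$ centred at $\mathbf{x}_0$. $\mathbf{F}^{-1}$ denotes the local $C^1$ inverse of $\mathbf{F}$ on a neighbourhood of $\mathbf{x}_0=\mathbf{F}(\mathbf{x}_0)$ with $\mathbf{F}^{-1}(\mathbf{x}_0)=\mathbf{x}_0$ (it exists by the Inverse Function Theorem). An orbit is identified with its set of points. Box dimension: for a bounded set $A\subset\mathbb{R}^N$ let $A_\varepsilon=\{y\in\mathbb{R}^N: d(y,A)<\varepsilon\}$ and let $|A_\varepsilon|$ be its Lebesgue measure. For $s\ge 0$ put $\mathcal{M}_*^s(A)=\liminf_{\varepsilon\to0}|A_\varepsilon|/\varepsilon^{N-s}$ and $\mathcal{M}^{*s}(A)=\limsup_{\varepsilon\to0}|A_\varepsilon|/\varepsilon^{N-s}$. The lower and upper box dimensions are $\underline{\dim}_B A=\inf\{s>0:\mathcal{M}_*^s(A)=0\}$ and $\overline{\dim}_B A=\inf\{s>0:\mathcal{M}^{*s}(A)=0\}$; if they coincide, the common value is denoted $\dim_B A$. The assertion $\dim_B A=d$ includes that both coincide. The assertion that the orbit has a box dimension includes that the orbit is well defined for all $j\in\mathbb{N}$. *)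

theory Defs
  imports "HOL-Analysis.Analysis"
begin

section \<open>Box dimension\<close>

(* The guard gives the empty set an empty neighbourhood (distance to it is infinite);
   infdist y {} is 0 in the library. *)
definition eps_nbhd :: "'a::metric_space set \<Rightarrow> real \<Rightarrow> 'a set" where
  "eps_nbhd A e = {y. A \<noteq> {} \<and> infdist y A < e}"

(* |A_e| / e^(N-s); the denominator is finite and positive for e > 0. *)
definition minkowski_ratio :: "real \<Rightarrow> 'a::euclidean_space set \<Rightarrow> real \<Rightarrow> ennreal" where
  "minkowski_ratio s A e =
     emeasure lebesgue (eps_nbhd A e) / ennreal (e powr (real DIM('a) - s))"

definition lower_minkowski_content :: "real \<Rightarrow> 'a::euclidean_space set \<Rightarrow> ennreal" where
  "lower_minkowski_content s A = Liminf (at_right 0) (minkowski_ratio s A)"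

definition upper_minkowski_content :: "real \<Rightarrow> 'a::euclidean_space set \<Rightarrow> ennreal" where
  "upper_minkowski_content s A = Limsup (at_right 0) (minkowski_ratio s A)"

(* Taken in ereal so that an infimum over an empty set of exponents is infinity. *)
definition lower_box_dim :: "'a::euclidean_space set \<Rightarrow> ereal" where
  "lower_box_dim A = (INF s \<in> {s. s > 0 \<and> lower_minkowski_content s A = 0}. ereal s)"

definition upper_box_dim :: "'a::euclidean_space set \<Rightarrow> ereal" where
  "upper_box_dim A = (INF s \<in> {s. s > 0 \<and> upper_minkowski_content s A = 0}. ereal s)"

definition has_box_dim :: "'a::euclidean_space set \<Rightarrow> real \<Rightarrow> bool" where
  "has_box_dim A d \<longleftrightarrow>
     bounded A \<and> lower_box_dim A = ereal d \<and> upper_box_dim A = ereal d"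


section \<open>Maps of class C1, eigenvalues, local inverses and orbits\<close>

(* Meant for open S. *)
definition C1_on :: "('a::real_normed_vector \<Rightarrow> 'b::real_normed_vector) \<Rightarrow> 'a set \<Rightarrow> bool" where
  "C1_on f S \<longleftrightarrow>
     (\<exists>f' :: 'a \<Rightarrow> ('a \<Rightarrow>\<^sub>L 'b).
        (\<forall>x\<in>S. (f has_derivative blinfun_apply (f' x)) (at x)) \<and> continuous_on S f')"

definition eigenvalue :: "'a::field ^ 'n ^ 'n \<Rightarrow> 'a \<Rightarrow> bool" where
  "eigenvalue A c \<longleftrightarrow> (\<exists>v. v \<noteq> 0 \<and> A *v v = c *s v)"

(* G, with domain V, is a local C1 inverse at the fixed point x0 of the map F with domain D.
   Values of G outside V are irrelevant. *)
definition local_C1_inverse ::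
  "('a::real_normed_vector \<Rightarrow> 'a) \<Rightarrow> 'a set \<Rightarrow> 'a \<Rightarrow> 'a set \<Rightarrow> ('a \<Rightarrow> 'a) \<Rightarrow> bool" where
  "local_C1_inverse F D x0 V G \<longleftrightarrow>
     open V \<and> x0 \<in> V \<and> G x0 = x0 \<and> C1_on G V \<and>
     (\<exists>U. open U \<and> x0 \<in> U \<and> U \<subseteq> D \<and> homeomorphism U V F G)"

(* Point set of the sequence x, G x, G (G x), ... *)
definition orbit_set :: "('a \<Rightarrow> 'a) \<Rightarrow> 'a \<Rightarrow> 'a set" where
  "orbit_set G x = range (\<lambda>j. (G ^^ j) x)"

end

theory Submission
  imports Defs "HOL-Computational_Algebra.Fundamental_Theorem_Algebra" "HOL-Real_Asymp.Real_Asymp"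
begin

text \<open>If a nonzero complex polynomial \<open>p\<close> satisfies \<open>p(B) v = 0\<close> and all eigenvalues of \<open>B\<close> have
  modulus less than 1, then \<open>B\<^sup>k v \<longlonglongrightarrow> 0\<close> by induction on the degree: split off a root \<open>l\<close> of
  \<open>p = (X - l) q\<close>; then \<open>w = B v - l v\<close> is annihilated by \<open>q\<close>. If \<open>|l| < 1\<close>, the recurrence
  \<open>B\<^sup>k\<^sup>+\<^sup>1 v = l B\<^sup>k v + B\<^sup>k w\<close> gives the claim; otherwise \<open>l\<close> is not an eigenvalue, so \<open>q(B) v = 0\<close>.
  Hence some power of \<open>DG(x0) = DF(x0)\<^sup>-\<^sup>1\<close> has norm below 1/2, and near \<open>x0\<close> the orbits of the local inverse
  \<open>G\<close> converge to \<open>x0\<close> geometrically. The \<open>e\<close>-neighbourhood of such an orbit is covered by a ball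
  of radius \<open>2 e\<close> and \<open>O(ln (1 / e))\<close> balls of radius \<open>e\<close>, so its volume is
  \<open>O(e\<^sup>N ln (1 / e))\<close>, which is \<open>o(e\<^sup>N\<^sup>-\<^sup>s)\<close> for every \<open>s > 0\<close>.\<close>

section \<open>Iterates of a matrix with small spectrum\<close>

text \<open>Once \<open>b\<close> stays below \<open>d\<close>, the recurrence is dominated by the
  affine map taking \<open>t\<close> to \<open>c * t + d\<close>, whose fixed point is
  \<open>e / 2\<close>; the excess over this fixed point shrinks by the factor \<open>c\<close> in
  every step.\<close>

lemma contracting_recurrence_tendsto_zero:
  fixes a b :: "nat \<Rightarrow> real"
  assumes c: "0 \<le> c" "c < 1" and a0: "\<And>k. 0 \<le> a k"
    and rec: "\<And>k. a (Suc k) \<le> c * a k + b k" and b: "b \<longlonglongrightarrow> 0"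
  shows "a \<longlonglongrightarrow> 0"
proof (rule LIMSEQ_I)
  fix e :: real assume "e > 0"
  define d where "d = e / 2 * (1 - c)"
  have "d > 0" using \<open>e > 0\<close> c by (simp add: d_def)
  then obtain N where N: "\<And>n. n \<ge> N \<Longrightarrow> \<bar>b n\<bar> < d"
    using LIMSEQ_D[OF b, of d] by auto
  have bound: "a (N + m) \<le> c ^ m * a N + e / 2" for m
  proof (induction m)
    case (Suc m)
    have "a (N + Suc m) \<le> c * a (N + m) + b (N + m)" using rec by simp
    also have "\<dots> \<le> c * (c ^ m * a N + e / 2) + d"
      using Suc N[of "N + m"] c by (intro add_mono mult_left_mono) auto
    also have "\<dots> = c ^ Suc m * a N + e / 2" by (simp add: d_def field_simps)
    finally show ?case .
  qed (use \<open>e > 0\<close> in simp)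
  have "(\<lambda>m. c ^ m * a N) \<longlonglongrightarrow> 0"
    using c by (intro tendsto_mult_left_zero LIMSEQ_power_zero) auto
  then obtain M where M: "\<And>m. m \<ge> M \<Longrightarrow> \<bar>c ^ m * a N\<bar> < e / 2"
    using LIMSEQ_D[of "\<lambda>m. c ^ m * a N" 0 "e / 2"] \<open>e > 0\<close> by auto
  have "norm (a n - 0) < e" if "n \<ge> N + M" for n
  proof -
    have "a n < e" using bound[of "n - N"] M[of "n - N"] that by fastforce
    then show ?thesis using a0[of n] by simp
  qed
  then show "\<exists>no. \<forall>n\<ge>no. norm (a n - 0) < e" by blast
qed

lemma norm_vector_scalar_mult_complex:
  fixes v :: "complex ^ 'n"
  shows "norm (c *s v) = cmod c * norm v"
  by (simp add: norm_vec_def norm_mult L2_set_right_distrib)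

text \<open>Horner's scheme for p(B) v. It stays with vectors and makes induction over
  \<open>pCons\<close> the natural proof method.\<close>

definition poly_act :: "'a::field poly \<Rightarrow> 'a ^ 'n ^ 'n \<Rightarrow> 'a ^ 'n \<Rightarrow> 'a ^ 'n" where
  "poly_act p B v = fold_coeffs (\<lambda>a w. a *s v + B *v w) p 0"

lemma poly_act_0 [simp]: "poly_act 0 B v = 0"
  by (simp add: poly_act_def)

lemma poly_act_pCons [simp]: "poly_act (pCons a p) B v = a *s v + B *v poly_act p B v"
  by (cases "p = 0 \<and> a = 0") (auto simp: poly_act_def)

lemma poly_act_add: "poly_act (p + q) B v = poly_act p B v + poly_act q B v"
  by (induction p q rule: poly_induct2)
     (auto simp: matrix_vector_right_distrib vector_sadd_rdistrib algebra_simps)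

lemma poly_act_smult: "poly_act (smult c p) B v = c *s poly_act p B v"
  by (induction p) (auto simp: vector_add_ldistrib vector_scalar_commute)

lemma poly_act_sum: "poly_act (\<Sum>i\<in>I. p i) B v = (\<Sum>i\<in>I. poly_act (p i) B v)"
  by (induction I rule: infinite_finite_induct) (auto simp: poly_act_add)

lemma poly_act_monom: "poly_act (monom c i) B v = c *s (((*v) B) ^^ i) v"
  by (induction i) (auto simp: monom_0 monom_Suc vector_scalar_commute)

lemma poly_act_linear_factor:
  "poly_act ([:- l, 1:] * q) B v = B *v poly_act q B v - l *s poly_act q B v"
  by (simp add: poly_act_add poly_act_smult algebra_simps flip: smult_minus_left)

text \<open>Polynomials in \<open>B\<close> commute with B - l. Together with
  \<open>poly_act_linear_factor\<close> this shows that q annihilates (B - l) v whenever (X - l) q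
  annihilates v.\<close>

lemma poly_act_commute:
  "poly_act q B (B *v v - l *s v) = B *v poly_act q B v - l *s poly_act q B v"
  by (induction q)
     (auto simp: matrix_vector_right_distrib matrix_vector_mult_diff_distrib vector_scalar_commute
        vector_add_ldistrib vector_ssub_ldistrib vector_smult_assoc mult.commute)

text \<open>A dimension count over the reals: the vectors v, B v, ..., B^n v are one more than the
  real dimension n, so a real linear relation holds among them, and its coefficients form p.\<close>

lemma annihilating_poly_exists:
  fixes B :: "complex ^ 'n ^ 'n"
  obtains p where "p \<noteq> 0" "poly_act p B v = 0"
proof -
  define f where "f i = (((*v) B) ^^ i) v" for i
  define n where "n = DIM(complex ^ 'n)"
  show ?thesis
  \<comment> \<open>Linear dependence concerns sets, so the count needs distinct vectors. A
    repetition f i = f j gives the annihilating polynomial X^i - X^j directly.\<close>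
  proof (cases "inj_on f {..n}")
    case True
    have "card (f ` {..n}) = Suc n" using True by (simp add: card_image)
    then have "dependent (f ` {..n})"
      by (intro dependent_biggerset) (auto simp: n_def)
    then obtain u where u: "\<exists>w\<in>f ` {..n}. u w \<noteq> 0" "(\<Sum>w\<in>f ` {..n}. u w *\<^sub>R w) = 0"
      by (auto simp: dependent_finite)
    define p where "p = (\<Sum>i\<le>n. monom (complex_of_real (u (f i))) i)"
    obtain i where i: "i \<le> n" "u (f i) \<noteq> 0" using u(1) by auto
    have "coeff p i = complex_of_real (u (f i))"
      using i by (simp add: p_def coeff_sum if_distrib sum.delta cong: if_cong)
    then have "p \<noteq> 0" using i by auto
    moreover have "poly_act p B v = (\<Sum>i\<le>n. u (f i) *\<^sub>R f i)"
      unfolding p_def poly_act_sum poly_act_monom f_def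
      by (simp add: vec_eq_iff) (simp add: scaleR_conv_of_real)
    then have "poly_act p B v = 0" using u(2) True by (simp add: sum.reindex)
    ultimately show ?thesis by (rule that)
  next
    case False
    then obtain i j where ij: "i \<noteq> j" "f i = f j" by (auto simp: inj_on_def)
    let ?p = "monom 1 i + smult (- 1) (monom 1 j) :: complex poly"
    have "coeff ?p i = 1" using ij by simp
    then have "?p \<noteq> 0" by (metis coeff_0 zero_neq_one)
    moreover have "poly_act ?p B v = 0"
      using ij unfolding poly_act_add poly_act_smult poly_act_monom by (simp add: f_def)
    ultimately show ?thesis by (rule that)
  qed
qed

lemma matrix_iterates_tendsto_zero_if_annihilated:
  fixes B :: "complex ^ 'n ^ 'n"
  assumes ev: "\<And>c. eigenvalue B c \<Longrightarrow> cmod c < 1"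
    and "p \<noteq> 0" "poly_act p B v = 0"
  shows "(\<lambda>k. (((*v) B) ^^ k) v) \<longlonglongrightarrow> 0"
  using assms(2,3)
\<comment> \<open>The vector varies too, because the induction hypothesis is applied to
  \<open>w\<close> and not only to \<open>v\<close>.\<close>
proof (induction "degree p" arbitrary: p v)
  case 0
  then obtain a where "p = [:a:]" by (metis degree_0_id degree_eq_zeroE)
  with 0 have "v = 0" by simp
  then have "(((*v) B) ^^ k) v = 0" for k by (induction k) auto
  then show ?case by simp
next
  case (Suc d)
  obtain l where "poly p l = 0"
    using Suc.hyps(2) fundamental_theorem_of_algebra[of p] by (auto simp: constant_degree)
  then obtain q where p: "p = [:- l, 1:] * q" by (auto simp: poly_eq_0_iff_dvd)
  have q: "q \<noteq> 0" using p Suc.prems by auto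
  have deg: "d = degree q" using p q Suc.hyps(2) degree_mult_eq[of "[:- l, 1:]" q] by simp
  define w where "w = B *v v - l *s v"
  have w0: "poly_act q B w = 0"
    unfolding w_def poly_act_commute using Suc.prems(2) p poly_act_linear_factor by metis
  have w: "(\<lambda>k. (((*v) B) ^^ k) w) \<longlonglongrightarrow> 0" using Suc.hyps(1)[OF deg q w0] .
  show ?case
  proof (cases "cmod l < 1")
    case True
    have "(((*v) B) ^^ Suc k) v = l *s (((*v) B) ^^ k) v + (((*v) B) ^^ k) w" for k
      by (induction k)
         (auto simp: w_def matrix_vector_right_distrib vector_scalar_commute)
    then have rec: "norm ((((*v) B) ^^ Suc k) v)
        \<le> cmod l * norm ((((*v) B) ^^ k) v) + norm ((((*v) B) ^^ k) w)" for k
      by (metis norm_triangle_ineq norm_vector_scalar_mult_complex)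
    have "(\<lambda>k. norm ((((*v) B) ^^ k) v)) \<longlonglongrightarrow> 0"
    proof (rule contracting_recurrence_tendsto_zero)
      show "(\<lambda>k. norm ((((*v) B) ^^ k) w)) \<longlonglongrightarrow> 0"
        using w by (rule tendsto_norm_zero)
    qed (use True rec in auto)
    then show ?thesis by (rule tendsto_norm_zero_cancel)
  next
    case False
    have "B *v poly_act q B v = l *s poly_act q B v"
      using Suc.prems(2) p poly_act_linear_factor[of l q B v] by simp
    \<comment> \<open>Otherwise q(B) v would be an eigenvector for \<open>l\<close>, although
      \<open>l\<close> has modulus at least 1.\<close>
    then have "poly_act q B v = 0" using False ev[of l] by (auto simp: eigenvalue_def)
    then show ?thesis using Suc.hyps(1)[OF deg q] by simp
  qed
qed

lemma matrix_iterates_tendsto_zero: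
  fixes B :: "complex ^ 'n ^ 'n"
  assumes "\<And>c. eigenvalue B c \<Longrightarrow> cmod c < 1"
  shows "(\<lambda>k. (((*v) B) ^^ k) v) \<longlonglongrightarrow> 0"
  using annihilating_poly_exists matrix_iterates_tendsto_zero_if_annihilated assms by metis

section \<open>Transfer from complex to real matrices\<close>

definition complexify :: "real ^ 'n \<Rightarrow> complex ^ 'n" where
  "complexify v = (\<chi> i. complex_of_real (v $ i))"

lemma norm_complexify [simp]: "norm (complexify v) = norm v"
  by (simp add: complexify_def norm_vec_def)

lemma complexify_matrix_mult:
  "map_matrix complex_of_real A *v complexify v = complexify (A *v v)"
  by (simp add: complexify_def vec_eq_iff matrix_vector_mult_def)

lemma complexify_matrix_iterates:
  fixes A :: "real ^ 'n ^ 'n"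
  shows "(((*v) (map_matrix complex_of_real A)) ^^ k) (complexify v) = complexify ((((*v) A) ^^ k) v)"
  by (induction k) (auto simp: complexify_matrix_mult)

lemma map_matrix_of_real_mult:
  "map_matrix complex_of_real (A ** B) = map_matrix complex_of_real A ** map_matrix complex_of_real B"
  by (simp add: vec_eq_iff matrix_matrix_mult_def)

lemma map_matrix_of_real_mat_1: "map_matrix complex_of_real (mat 1) = mat 1"
  by (simp add: vec_eq_iff mat_def)

text \<open>Applying \<open>A\<close> to B v = c v gives v = c A v; since v is nonzero, so is c, and
  the same v is an eigenvector of \<open>A\<close>.\<close>

lemma eigenvalue_inverse:
  fixes A B :: "'a::field ^ 'n ^ 'n"
  assumes AB: "A ** B = mat 1" and "eigenvalue B c"
  shows "c \<noteq> 0" "eigenvalue A (inverse c)"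
proof -
  obtain v where v: "v \<noteq> 0" "B *v v = c *s v" using assms by (auto simp: eigenvalue_def)
  have "v = A *v (B *v v)" by (simp add: matrix_vector_mul_assoc AB)
  also have "\<dots> = c *s (A *v v)" by (simp add: v vector_scalar_commute)
  finally have *: "v = c *s (A *v v)" .
  then show "c \<noteq> 0" using v by auto
  then have "A *v v = inverse c *s v"
    by (subst (2) *) (simp add: vector_smult_assoc)
  then show "eigenvalue A (inverse c)" using v by (auto simp: eigenvalue_def)
qed

lemma small_onorm_iterate:
  fixes A B :: "real ^ 'n ^ 'n"
  assumes ev: "\<And>c :: complex. eigenvalue (map_matrix complex_of_real A) c \<Longrightarrow> cmod c > 1"
    and AB: "A ** B = mat 1" and "e > 0"
  obtains k where "k > 0" "onorm (((*v) B) ^^ k) < e"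
proof -
  let ?C = "map_matrix complex_of_real"
  have "?C A ** ?C B = mat 1"
    using AB by (metis map_matrix_of_real_mult map_matrix_of_real_mat_1)
  then have "cmod c < 1" if "eigenvalue (?C B) c" for c
    using eigenvalue_inverse[of "?C A" "?C B" c] that ev[of "inverse c"]
    by (simp add: norm_inverse one_less_inverse_iff)
  then have "(\<lambda>k. complexify ((((*v) B) ^^ k) b)) \<longlonglongrightarrow> 0" for b
    using matrix_iterates_tendsto_zero[of "?C B" "complexify b"]
    by (simp add: complexify_matrix_iterates)
  then have "(\<lambda>k. norm ((((*v) B) ^^ k) b)) \<longlonglongrightarrow> 0" for b
    by (subst norm_complexify[symmetric]) (rule tendsto_norm_zero)
  \<comment> \<open>Pointwise convergence becomes convergence in operator norm: the norms of the
    images of the finitely many basis vectors add up to a bound for \<open>onorm\<close>.\<close>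
  then have "(\<lambda>k. \<Sum>b\<in>Basis. norm ((((*v) B) ^^ k) b)) \<longlonglongrightarrow> 0"
    by (intro tendsto_null_sum)
  then have "\<forall>\<^sub>F k in sequentially. (\<Sum>b\<in>Basis. norm ((((*v) B) ^^ k) b)) < e"
    using \<open>e > 0\<close> by (rule order_tendstoD)
  then obtain N where N: "\<And>k. k \<ge> N \<Longrightarrow> (\<Sum>b\<in>Basis. norm ((((*v) B) ^^ k) b)) < e"
    by (auto simp: eventually_sequentially)
  have "bounded_linear (((*v) B) ^^ k)" for k
  proof (induction k)
    case (Suc k)
    then show ?case
      using bounded_linear_compose[OF matrix_vector_mul_bounded_linear[of B]] by (simp add: o_def)
  qed (simp add: id_def)
  \<comment> \<open>\<open>Suc N\<close> instead of \<open>N\<close> guarantees a positive exponent,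
    by which indices are divided later.\<close>
  then have "onorm (((*v) B) ^^ Suc N) < e"
    by (rule le_less_trans[OF onorm_componentwise N]) simp
  then show ?thesis using that[of "Suc N"] by simp
qed

section \<open>Box dimension of geometrically convergent sequences\<close>

text \<open>Both contents vanish for every positive s, so both dimensions are the infimum of all
  positive reals, which is 0 without being attained.\<close>

lemma box_dim_eq_0I:
  fixes A :: "'a::euclidean_space set"
  assumes "bounded A" and lim: "\<And>s. s > 0 \<Longrightarrow> (minkowski_ratio s A \<longlongrightarrow> 0) (at_right 0)"
  shows "has_box_dim A 0"
proof -
  have "(INF s \<in> {0<..}. ereal s) = 0"
  proof (rule antisym)
    show "(INF s \<in> {0<..}. ereal s) \<le> 0"
      by (rule ereal_le_epsilon2) (auto intro: INF_lower)
  qed (auto intro: INF_greatest)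
  moreover have "{s. s > 0 \<and> lower_minkowski_content s A = 0} = {0<..}"
    using lim by (auto simp: lower_minkowski_content_def intro: lim_imp_Liminf)
  moreover have "{s. s > 0 \<and> upper_minkowski_content s A = 0} = {0<..}"
    using lim by (auto simp: upper_minkowski_content_def intro: lim_imp_Limsup)
  ultimately show ?thesis
    using \<open>bounded A\<close> by (simp add: has_box_dim_def lower_box_dim_def upper_box_dim_def zero_ereal_def)
qed

lemma eps_nbhd_range_subset:
  fixes x :: "nat \<Rightarrow> 'a::metric_space"
  assumes tail: "\<And>j. j \<ge> J \<Longrightarrow> dist (x j) a \<le> e"
  shows "eps_nbhd (range x) e \<subseteq> ball a (2 * e) \<union> (\<Union>j<J. ball (x j) e)"
proof
  fix y assume "y \<in> eps_nbhd (range x) e"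
  then have "infdist y (range x) < e" by (simp add: eps_nbhd_def)
  then obtain j where j: "dist y (x j) < e"
    by (auto simp: infdist_def cINF_less_iff)
  show "y \<in> ball a (2 * e) \<union> (\<Union>j<J. ball (x j) e)"
  proof (cases "j < J")
    case False
    then have "dist (x j) a \<le> e" using tail by simp
    then have "dist y a < 2 * e"
      using j dist_triangle[of y a "x j"] by linarith
    then show ?thesis by (simp add: dist_commute)
  qed (use j in \<open>auto simp: dist_commute\<close>)
qed

lemma emeasure_eps_nbhd_range_le:
  fixes x :: "nat \<Rightarrow> 'a::euclidean_space"
  assumes "e > 0" and tail: "\<And>j. j \<ge> J \<Longrightarrow> dist (x j) a \<le> e"
  shows "emeasure lebesgue (eps_nbhd (range x) e)
    \<le> ennreal (unit_ball_vol (DIM('a)) * (real J + 2 ^ DIM('a)) * e ^ DIM('a))"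
proof -
  let ?N = "DIM('a)" and ?w = "unit_ball_vol (real DIM('a))"
  have "emeasure lebesgue (eps_nbhd (range x) e)
      \<le> emeasure lebesgue (ball a (2 * e) \<union> (\<Union>j<J. ball (x j) e))"
    by (rule emeasure_mono[OF eps_nbhd_range_subset[OF tail]]) auto
  also have "\<dots> \<le> emeasure lebesgue (ball a (2 * e)) + emeasure lebesgue (\<Union>j<J. ball (x j) e)"
    by (rule emeasure_subadditive) auto
  also have "\<dots> \<le> emeasure lebesgue (ball a (2 * e)) + (\<Sum>j<J. emeasure lebesgue (ball (x j) e))"
    by (intro add_mono emeasure_subadditive_finite) auto
  also have "\<dots> = ennreal (?w * (2 * e) ^ ?N) + (\<Sum>j<J. ennreal (?w * e ^ ?N))"
    using \<open>e > 0\<close> by (simp add: emeasure_ball)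
  also have "\<dots> = ennreal (?w * (2 * e) ^ ?N + (\<Sum>j<J. ?w * e ^ ?N))"
    using \<open>e > 0\<close> by (subst sum_ennreal) (auto simp flip: ennreal_plus)
  also have "\<dots> = ennreal (?w * (real J + 2 ^ ?N) * e ^ ?N)"
    by (simp add: algebra_simps)
  finally show ?thesis .
qed

text \<open>The exponent \<open>j div k\<close> fits orbits that are known to contract only over
  blocks of \<open>k\<close> steps. It multiplies the number of balls of radius e by the constant
  \<open>k\<close> and leaves its logarithmic order unchanged.\<close>

lemma box_dim_range_geometric_decay:
  fixes x :: "nat \<Rightarrow> 'a::euclidean_space"
  assumes C: "C > 0" and t: "0 < t" "t < 1" and "k > 0"
    and decay: "\<And>j. dist (x j) a \<le> C * t ^ (j div k)"
  shows "has_box_dim (range x) 0"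
proof (rule box_dim_eq_0I)
  have "dist a (x j) \<le> C" for j
  proof -
    have "C * t ^ (j div k) \<le> C" using t C by (simp add: mult_left_le power_le_one)
    then show ?thesis using decay[of j] unfolding dist_commute[of a] by linarith
  qed
  then have "range x \<subseteq> cball a C" by auto
  then show "bounded (range x)" by (rule bounded_subset[OF bounded_cball])
next
  fix s :: real assume "s > 0"
  let ?N = "DIM('a)" and ?w = "unit_ball_vol (real DIM('a))"
  \<comment> \<open>Solving C t^M = e for M gives (ln C - ln e) / (- ln t). The summand 1 pays for
    rounding up, and the absolute value covers e > C, where the quotient is negative.\<close>
  define K where "K e = \<bar>ln C - ln e\<bar> / (- ln t) + 1" for e
  define h where "h e = ?w * (real k * K e + 2 ^ ?N) * e powr s" for e
  have "ln t < 0" using t by simp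
  have ratio: "minkowski_ratio s (range x) e \<le> ennreal (h e)" if "e > 0" for e
  proof -
    define M where "M = nat \<lceil>(ln C - ln e) / (- ln t)\<rceil>"
    have "(ln C - ln e) / (- ln t) \<le> real M" unfolding M_def by linarith
    then have "ln C - ln e \<le> real M * (- ln t)"
      using \<open>ln t < 0\<close> by (simp add: divide_le_eq field_simps)
    then have "ln (C * t ^ M) \<le> ln e"
      using C t by (simp add: ln_mult ln_realpow)
    then have M: "C * t ^ M \<le> e" using C t \<open>e > 0\<close> by simp
    \<comment> \<open>After \<open>M\<close> blocks of length \<open>k\<close> the sequence has
      entered the ball that covers the whole tail.\<close>
    have tail: "dist (x j) a \<le> e" if "j \<ge> k * M" for j
    proof -
      have "M \<le> j div k"
        using that \<open>k > 0\<close> by (simp add: less_eq_div_iff_mult_less_eq mult.commute)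
      then have "C * t ^ (j div k) \<le> C * t ^ M"
        using t C by (intro mult_left_mono power_decreasing) auto
      then show ?thesis using decay[of j] M by linarith
    qed
    have "(ln C - ln e) / (- ln t) \<le> \<bar>ln C - ln e\<bar> / (- ln t)"
      using \<open>ln t < 0\<close> by (intro divide_right_mono) auto
    moreover have "0 \<le> \<bar>ln C - ln e\<bar> / (- ln t)"
      using \<open>ln t < 0\<close> by (intro divide_nonneg_pos) auto
    ultimately have MK: "real M \<le> K e" unfolding M_def K_def by linarith
    have pw: "e ^ ?N / e powr (real ?N - s) = e powr s"
      using \<open>e > 0\<close> by (simp add: powr_diff powr_realpow)
    have "minkowski_ratio s (range x) e
        \<le> ennreal (?w * (real (k * M) + 2 ^ ?N) * e ^ ?N) / ennreal (e powr (real ?N - s))"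
      unfolding minkowski_ratio_def
      by (intro divide_right_mono_ennreal emeasure_eps_nbhd_range_le[OF \<open>e > 0\<close> tail])
    also have "\<dots> = ennreal (?w * (real (k * M) + 2 ^ ?N) * e ^ ?N / e powr (real ?N - s))"
      using \<open>e > 0\<close> by (intro divide_ennreal) auto
    also have "\<dots> = ennreal (?w * (real k * real M + 2 ^ ?N) * e powr s)"
      by (simp flip: pw)
    also have "\<dots> \<le> ennreal (h e)"
      unfolding h_def using MK by (intro ennreal_leI mult_right_mono mult_left_mono add_mono) auto
    finally show ?thesis .
  qed
  have "((\<lambda>e. e powr s) \<longlongrightarrow> 0) (at_right 0)" "((\<lambda>e. \<bar>ln C - ln e\<bar> * e powr s) \<longlongrightarrow> 0) (at_right 0)"
    using \<open>s > 0\<close> by real_asymp+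
  \<comment> \<open>This is \<open>h\<close> with e^s multiplied out: the logarithm is unbounded
    near 0 and has a limit only together with that factor.\<close>
  then have "((\<lambda>e. ?w * (real k * ((\<bar>ln C - ln e\<bar> * e powr s) / (- ln t) + e powr s) + 2 ^ ?N * e powr s))
      \<longlongrightarrow> ?w * (real k * (0 / (- ln t) + 0) + 2 ^ ?N * 0)) (at_right 0)"
    using \<open>ln t < 0\<close> by (intro tendsto_intros) auto
  moreover have "(\<lambda>e. ?w * (real k * ((\<bar>ln C - ln e\<bar> * e powr s) / (- ln t) + e powr s) + 2 ^ ?N * e powr s)) = h"
    by (rule ext) (simp add: h_def K_def algebra_simps)
  ultimately have "(h \<longlongrightarrow> 0) (at_right 0)" by simp
  then have h: "((\<lambda>e. ennreal (h e)) \<longlongrightarrow> 0) (at_right 0)"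
    using tendsto_ennrealI by fastforce
  have "\<forall>\<^sub>F e in at_right 0. minkowski_ratio s (range x) e \<le> ennreal (h e)"
    using ratio by (auto simp: eventually_at_filter)
  then show "(minkowski_ratio s (range x) \<longlongrightarrow> 0) (at_right 0)"
    by (rule tendsto_sandwich[where f = "\<lambda>_. 0", rotated, OF _ tendsto_const h]) simp
qed

section \<open>Contracting iterates at a fixed point\<close>

lemma has_derivative_funpow_fixed_point:
  assumes "(G has_derivative G') (at x0)" and "G x0 = x0"
  shows "(G ^^ n has_derivative G' ^^ n) (at x0)"
proof (induction n)
  case (Suc n)
  have "(G ^^ n) x0 = x0" by (induction n) (auto simp: assms)
  then show ?case using diff_chain_at[OF Suc, of G G'] assms(1) by (simp add: o_def)
qed (simp add: id_def)

text \<open>The gap between \<open>L\<close> and \<open>onorm f'\<close> absorbs the remainder of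
  the linear approximation near \<open>x0\<close>.\<close>

lemma has_derivative_fixed_point_bound:
  fixes f :: "'a::real_normed_vector \<Rightarrow> 'a"
  assumes f': "(f has_derivative f') (at x0)" and "f x0 = x0" and "onorm f' < L"
  shows "\<exists>d>0. \<forall>x. dist x x0 < d \<longrightarrow> dist (f x) x0 \<le> L * dist x x0"
proof -
  have "L - onorm f' > 0" using assms by simp
  then obtain d where d: "d > 0"
    "\<And>y. norm (y - x0) < d \<Longrightarrow> norm (f y - f x0 - f' (y - x0)) \<le> (L - onorm f') * norm (y - x0)"
    using f' unfolding has_derivative_at_alt by blast
  have "dist (f x) x0 \<le> L * dist x x0" if "dist x x0 < d" for x
  proof -
    have "norm (f x - x0) \<le> norm (f x - f x0 - f' (x - x0)) + norm (f' (x - x0))"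
      using norm_triangle_ineq[of "f x - f x0 - f' (x - x0)" "f' (x - x0)"] \<open>f x0 = x0\<close> by simp
    also have "\<dots> \<le> (L - onorm f') * norm (x - x0) + onorm f' * norm (x - x0)"
      using d(2)[of x] that onorm[OF has_derivative_bounded_linear[OF f'], of "x - x0"]
      by (auto simp: dist_norm)
    finally show ?thesis by (simp add: dist_norm algebra_simps)
  qed
  with d(1) show ?thesis by blast
qed

text \<open>Only the \<open>k\<close>-th iterate contracts, so an orbit may move away from \<open>x0\<close> by the factor
  \<open>L ^ k\<close> before it returns; the radius \<open>r1\<close> makes up for this factor.\<close>
lemma orbit_decay_if_iterate_contracts:
  fixes G :: "'a::real_normed_vector \<Rightarrow> 'a"
  assumes G': "(G has_derivative G') (at x0)" and fixed: "G x0 = x0"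
    and k: "k > 0" "onorm (G' ^^ k) < 1 / 2"
    and "open V" "x0 \<in> V" "r > 0"
  obtains r1 C where "0 < r1" "r1 < r" "C > 0"
    "\<And>x j. x \<in> ball x0 r1 \<Longrightarrow> (G ^^ j) x \<in> V"
    "\<And>x j. x \<in> ball x0 r1 \<Longrightarrow> dist ((G ^^ j) x) x0 \<le> C * (1 / 2) ^ (j div k)"
proof -
  \<comment> \<open>The maximum with 1 makes the powers of \<open>L\<close> increasing, so
    \<open>L ^ k\<close> bounds every growth factor met within one block.\<close>
  define L where "L = max 1 (onorm G' + 1)"
  have L: "L \<ge> 1" "onorm G' < L" by (auto simp: L_def)
  have fixedk: "(G ^^ k) x0 = x0" by (induction k) (auto simp: fixed)
  obtain d1 where d1: "d1 > 0" "\<And>x. dist x x0 < d1 \<Longrightarrow> dist (G x) x0 \<le> L * dist x x0"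
    using has_derivative_fixed_point_bound[OF G' fixed L(2)] by blast
  obtain d2 where d2: "d2 > 0" "\<And>x. dist x x0 < d2 \<Longrightarrow> dist ((G ^^ k) x) x0 \<le> 1 / 2 * dist x x0"
    using has_derivative_fixed_point_bound[OF has_derivative_funpow_fixed_point[OF G' fixed] fixedk k(2)]
    by blast
  obtain d3 where d3: "d3 > 0" "ball x0 d3 \<subseteq> V"
    using \<open>open V\<close> \<open>x0 \<in> V\<close> by (meson openE)
  define d where "d = Min {d1, d2, d3, r / 2}"
  have d: "d > 0" "d \<le> d1" "d \<le> d2" "d \<le> d3" "d < r"
    using d1(1) d2(1) d3(1) \<open>r > 0\<close> by (auto simp: d_def min_def)
  define r1 where "r1 = d / L ^ k"
  have Lk: "L ^ i \<le> L ^ k" if "i \<le> k" for i using L that by (simp add: power_increasing)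
  have Lk1: "1 \<le> L ^ k" using L by simp
  have r1: "r1 > 0" "r1 \<le> d" "L ^ k * r1 = d"
    using d L Lk1 by (auto simp: r1_def divide_le_eq)
  \<comment> \<open>The first bound gives the decay; the strict second one keeps the orbit in the
    open ball of radius \<open>d\<close>, hence in \<open>V\<close>.\<close>
  have bound: "dist ((G ^^ j) x) x0 \<le> d * (1 / 2) ^ (j div k) \<and> dist ((G ^^ j) x) x0 < d"
    if x: "x \<in> ball x0 r1" for x j
  proof -
    have xr: "dist x x0 < r1" using x by (simp add: dist_commute)
    have multiples: "dist ((G ^^ (m * k)) x) x0 \<le> (1 / 2) ^ m * dist x x0" for m
    proof (induction m)
      case (Suc m)
      have "(1 / 2) ^ m * dist x x0 \<le> dist x x0" by (simp add: mult_left_le_one_le power_le_one)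
      then have "dist ((G ^^ (m * k)) x) x0 < d2" using Suc xr r1 d by linarith
      then have "dist ((G ^^ k) ((G ^^ (m * k)) x)) x0 \<le> 1 / 2 * ((1 / 2) ^ m * dist x x0)"
        using d2(2) Suc by fastforce
      then show ?case by (simp add: funpow_add)
    qed simp
    \<comment> \<open>Reach index j by \<open>m\<close> contracting blocks followed by
      \<open>j mod k\<close> single steps, each of which expands by at most
      \<open>L\<close>.\<close>
    define m where "m = j div k"
    have step: "dist ((G ^^ (i + m * k)) x) x0 \<le> L ^ i * ((1 / 2) ^ m * dist x x0)"
      if "i \<le> k" for i
      using that
    proof (induction i)
      case 0
      then show ?case using multiples[of m] by simp
    next
      case (Suc i)
      \<comment> \<open>The one-step bound holds only within distance \<open>d1\<close>; the choice
        L^k r1 = d keeps every intermediate point that close.\<close>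
      have "L ^ i * ((1 / 2) ^ m * dist x x0) \<le> L ^ k * (1 * dist x x0)"
        using Suc.prems L by (intro mult_mono Lk) (auto simp: power_le_one)
      also have "\<dots> < d" using xr Lk1 r1(3) mult_strict_left_mono[OF xr, of "L ^ k"] by simp
      finally have "dist ((G ^^ (i + m * k)) x) x0 < d1" using Suc d by simp
      then have "dist (G ((G ^^ (i + m * k)) x)) x0 \<le> L * dist ((G ^^ (i + m * k)) x) x0"
        by (rule d1(2))
      also have "\<dots> \<le> L * (L ^ i * ((1 / 2) ^ m * dist x x0))"
        using Suc L by (intro mult_left_mono) auto
      finally show ?case by (simp add: mult.assoc)
    qed
    have i: "j mod k \<le> k" using k by (simp add: less_imp_le)
    have "j mod k + m * k = j" by (simp add: m_def)
    then have "dist ((G ^^ j) x) x0 \<le> L ^ (j mod k) * ((1 / 2) ^ m * dist x x0)"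
      using step[OF i] by simp
    also have "\<dots> \<le> L ^ k * ((1 / 2) ^ m * dist x x0)"
      using Lk[OF i] by (intro mult_right_mono) auto
    finally have le: "dist ((G ^^ j) x) x0 \<le> (1 / 2) ^ m * (L ^ k * dist x x0)"
      by (simp add: mult_ac)
    have lt: "L ^ k * dist x x0 < d"
      using r1(3) mult_strict_left_mono[OF xr, of "L ^ k"] Lk1 by simp
    have "(1 / 2) ^ m * (L ^ k * dist x x0) \<le> (1 / 2) ^ m * d"
      using lt by (intro mult_left_mono) auto
    moreover have "(1 / 2) ^ m * (L ^ k * dist x x0) \<le> L ^ k * dist x x0"
      using Lk1 by (intro mult_left_le_one_le) (auto simp: power_le_one)
    ultimately have "dist ((G ^^ j) x) x0 \<le> (1 / 2) ^ m * d \<and> dist ((G ^^ j) x) x0 < d"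
      using le lt by linarith
    then show ?thesis by (simp add: m_def mult.commute)
  qed
  show ?thesis
  proof (rule that[of r1 d])
    show "(G ^^ j) x \<in> V" if "x \<in> ball x0 r1" for x j
      using bound[OF that, of j] d d3(2) by (auto simp: dist_commute)
  qed (use r1 d bound in auto)
qed

section \<open>Local inverses\<close>

text \<open>The resolvent-type identity S z - S y = S z (T y - T z) S y bounds the difference by the
  variation of \<open>T\<close>, as soon as the norm of \<open>S z\<close> is bounded near
  y.\<close>

lemma continuous_on_blinfun_inverse:
  fixes T S :: "'a::topological_space \<Rightarrow> 'b::real_normed_vector \<Rightarrow>\<^sub>L 'b"
  assumes T: "continuous_on V T"
    and inv: "\<And>y. y \<in> V \<Longrightarrow> T y o\<^sub>L S y = id_blinfun" "\<And>y. y \<in> V \<Longrightarrow> S y o\<^sub>L T y = id_blinfun"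
  shows "continuous_on V S"
  unfolding continuous_on_def
proof
  fix y assume y: "y \<in> V"
  let ?c = "norm (S y)" and ?F = "at y within V"
  define n where "n z = norm (T y - T z)" for z
  have "(T \<longlongrightarrow> T y) ?F" using T y by (simp add: continuous_on_def)
  then have "((\<lambda>z. T y - T z) \<longlongrightarrow> T y - T y) ?F" by (intro tendsto_diff tendsto_const)
  then have n: "(n \<longlongrightarrow> 0) ?F" unfolding n_def by (intro tendsto_norm_zero) simp
  then have small: "\<forall>\<^sub>F z in ?F. n z * ?c < 1 / 2"
    by (intro order_tendstoD(2)[OF tendsto_mult_left_zero]) auto
  have inV: "\<forall>\<^sub>F z in ?F. z \<in> V" by (simp add: eventually_at_filter)
  have "\<forall>\<^sub>F z in ?F. dist (S z) (S y) \<le> 2 * ?c * n z * ?c"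
    using eventually_conj[OF small inV]
  proof (rule eventually_mono)
    fix z assume "n z * ?c < 1 / 2 \<and> z \<in> V"
    then have z: "n z * ?c < 1 / 2" "z \<in> V" by auto
    have "S z - S y = S z o\<^sub>L (T y - T z) o\<^sub>L S y"
    proof (rule blinfun_eqI)
      fix v
      have "S z (T z (S y v)) = S y v" "T y (S y v) = v"
        using inv(1)[OF y] inv(2)[OF z(2)]
        by (metis blinfun_apply_blinfun_compose blinfun_apply_id_blinfun)+
      then show "(S z - S y) v = (S z o\<^sub>L (T y - T z) o\<^sub>L S y) v"
        by (simp add: blinfun.diff_left blinfun.diff_right)
    qed
    then have "norm (S z - S y) \<le> norm (S z o\<^sub>L (T y - T z)) * ?c"
      by (metis norm_blinfun_compose)
    also have "\<dots> \<le> norm (S z) * n z * ?c"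
      unfolding n_def by (intro mult_right_mono norm_blinfun_compose) auto
    finally have le: "norm (S z - S y) \<le> norm (S z) * (n z * ?c)" by simp
    also have "\<dots> \<le> norm (S z) * (1 / 2)" using z by (intro mult_left_mono) auto
    \<comment> \<open>The difference is at most half of the norm of \<open>S z\<close>, and this
      half is absorbed on the left.\<close>
    finally have "norm (S z) \<le> 2 * ?c" using norm_triangle_sub[of "S z" "S y"] by simp
    then have "norm (S z) * (n z * ?c) \<le> 2 * ?c * (n z * ?c)"
      by (intro mult_right_mono) (auto simp: n_def)
    with le show "dist (S z) (S y) \<le> 2 * ?c * n z * ?c" by (simp add: dist_norm mult.assoc)
  qed
  moreover have "((\<lambda>z. 2 * ?c * n z * ?c) \<longlongrightarrow> 0) ?F"
    by (intro tendsto_mult_left_zero tendsto_mult_right_zero n)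
  ultimately have "((\<lambda>z. dist (S z) (S y)) \<longlongrightarrow> 0) ?F"
    by (rule tendsto_sandwich[where f = "\<lambda>_. 0", OF _ _ tendsto_const, rotated]) simp
  then show "(S \<longlongrightarrow> S y) ?F" by (subst tendsto_dist_iff)
qed

text \<open>The inverse function theorem yields a local inverse with a pointwise derivative; that
  this derivative varies continuously follows from the continuity of inversion of operators.\<close>

lemma local_C1_inverse_exists:
  fixes F :: "'a::euclidean_space \<Rightarrow> 'a"
  assumes "open D" "x0 \<in> D" "F x0 = x0"
    and F': "\<And>x. x \<in> D \<Longrightarrow> (F has_derivative blinfun_apply (F' x)) (at x)"
    and cont: "continuous_on D F'" and inv: "B o\<^sub>L F' x0 = id_blinfun"
  shows "\<exists>V G. local_C1_inverse F D x0 V G"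
proof -
  obtain U V g g' where U: "open U" "U \<subseteq> D" "x0 \<in> U" and V: "open V" "F x0 \<in> V"
    and hom: "homeomorphism U V F g"
    and g': "\<And>y. y \<in> V \<Longrightarrow> (g has_derivative (g' y)) (at y)"
      "\<And>y. y \<in> V \<Longrightarrow> g' y = Hilbert_Choice.inv (blinfun_apply (F' (g y)))"
      "\<And>y. y \<in> V \<Longrightarrow> bij (blinfun_apply (F' (g y)))"
    using inverse_function_theorem[OF \<open>open D\<close> F' cont \<open>x0 \<in> D\<close> inv] by blast
  \<comment> \<open>\<open>C1_on\<close> asks for continuity in operator norm, so the derivatives
    are packed as bounded linear maps.\<close>
  define S where "S y = Blinfun (g' y)" for y
  have S: "blinfun_apply (S y) = g' y" if "y \<in> V" for y
    using g'(1)[OF that] unfolding S_def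
    by (intro bounded_linear_Blinfun_apply has_derivative_bounded_linear)
  have "continuous_on V S"
  proof (rule continuous_on_blinfun_inverse)
    have "continuous_on V g" "g ` V \<subseteq> D" using hom U by (auto simp: homeomorphism_def)
    then show "continuous_on V (\<lambda>y. F' (g y))"
      by (intro continuous_on_compose2[OF cont]) auto
    fix y assume y: "y \<in> V"
    show "F' (g y) o\<^sub>L S y = id_blinfun"
      by (rule blinfun_eqI) (simp add: S[OF y] g'(2)[OF y] surj_f_inv_f[OF bij_is_surj[OF g'(3)[OF y]]])
    show "S y o\<^sub>L F' (g y) = id_blinfun"
      by (rule blinfun_eqI) (simp add: S[OF y] g'(2)[OF y] inv_f_f[OF bij_is_inj[OF g'(3)[OF y]]])
  qed
  then have "C1_on g V" unfolding C1_on_def using g'(1) S by metis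
  moreover have "g x0 = x0" using hom U \<open>F x0 = x0\<close> by (metis homeomorphism_apply1)
  ultimately have "local_C1_inverse F D x0 V g"
    unfolding local_C1_inverse_def using U V hom \<open>F x0 = x0\<close> by auto
  then show ?thesis by blast
qed

lemma matrix_left_inverse_if_no_zero_eigenvalue:
  fixes A :: "real ^ 'n ^ 'n"
  assumes "\<not> eigenvalue (map_matrix complex_of_real A) 0"
  obtains B where "B ** A = mat 1"
proof -
  have "v = 0" if "A *v v = 0" for v
  proof -
    \<comment> \<open>A nonzero real kernel vector would become a complex eigenvector for the
      eigenvalue 0.\<close>
    have "map_matrix complex_of_real A *v complexify v = 0 *s complexify v"
      using that by (simp add: complexify_matrix_mult) (simp add: complexify_def vec_eq_iff)
    then have "complexify v = 0" using assms by (auto simp: eigenvalue_def)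
    then show ?thesis by (metis norm_complexify norm_eq_zero)
  qed
  then show ?thesis using that matrix_left_invertible_ker by blast
qed

text \<open>As \<open>G\<close> is a total function with arbitrary values outside \<open>V\<close>,
  the inclusion of the orbit in \<open>V\<close> expresses that the orbit is well defined. The
  second conjunct treats an arbitrary local inverse, so the result does not depend on the one
  constructed for the first.\<close>

theorem corollary1:
  fixes F :: "real ^ 'n \<Rightarrow> real ^ 'n" and x0 :: "real ^ 'n" and r :: real
  assumes "r > 0"
    and "C1_on F (ball x0 r)"
    and "F x0 = x0"
    and "\<And>c :: complex. eigenvalue (map_matrix complex_of_real (jacobian F (at x0))) c \<Longrightarrow> cmod c > 1"
  shows "(\<exists>V G. local_C1_inverse F (ball x0 r) x0 V G) \<and>
         (\<forall>V G. local_C1_inverse F (ball x0 r) x0 V G \<longrightarrow>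
            (\<exists>r1. 0 < r1 \<and> r1 < r \<and>
              (\<forall>x1 \<in> ball x0 r1. orbit_set G x1 \<subseteq> V \<and> has_box_dim (orbit_set G x1) 0)))"
proof (intro conjI allI impI)
  obtain F' where F': "\<And>x. x \<in> ball x0 r \<Longrightarrow> (F has_derivative blinfun_apply (F' x)) (at x)"
    and cont: "continuous_on (ball x0 r) F'"
    using assms(2) unfolding C1_on_def by blast
  have x0: "x0 \<in> ball x0 r" using \<open>r > 0\<close> by simp
  define A where "A = jacobian F (at x0)"
  have A: "blinfun_apply (F' x0) = (*v) A"
    using frechet_derivative_at[OF F'[OF x0]] has_derivative_linear[OF F'[OF x0]]
    by (simp add: A_def jacobian_def)
  have ev: "\<And>c. eigenvalue (map_matrix complex_of_real A) c \<Longrightarrow> cmod c > 1"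
    using assms(4) by (simp add: A_def)
  then have "\<not> eigenvalue (map_matrix complex_of_real A) 0" by force
  then obtain B where B: "B ** A = mat 1" by (rule matrix_left_inverse_if_no_zero_eigenvalue)
  have inv: "Blinfun ((*v) B) o\<^sub>L F' x0 = id_blinfun"
    by (rule blinfun_eqI)
       (simp add: A bounded_linear_Blinfun_apply matrix_vector_mul_bounded_linear
          matrix_vector_mul_assoc B)
  show "\<exists>V G. local_C1_inverse F (ball x0 r) x0 V G"
    using local_C1_inverse_exists[OF open_ball x0 \<open>F x0 = x0\<close> F' cont inv] by blast
  fix V G assume "local_C1_inverse F (ball x0 r) x0 V G"
  then obtain U G' where V: "open V" "x0 \<in> V" and fixed: "G x0 = x0"
    and hom: "homeomorphism U V F G"
    and G': "(G has_derivative blinfun_apply G') (at x0)"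
    unfolding local_C1_inverse_def C1_on_def by blast
  \<comment> \<open>Since \<open>G\<close> is arbitrary, its derivative has to be identified:
    differentiating F o G = id at the fixed point shows that \<open>M\<close> is a right inverse of
    \<open>A\<close>.\<close>
  define M where "M = matrix (blinfun_apply G')"
  have M: "blinfun_apply G' = (*v) M"
    using has_derivative_linear[OF G'] by (simp add: M_def)
  have "(F \<circ> G has_derivative (*v) A \<circ> (*v) M) (at x0)"
    using diff_chain_at[OF G', of F] F'[OF x0] by (simp add: fixed A M)
  \<comment> \<open>F o G is known to be the identity only on \<open>V\<close>, which suffices
    because \<open>V\<close> is an open neighbourhood of \<open>x0\<close>.\<close>
  moreover have "(F \<circ> G has_derivative id) (at x0)"
    by (rule has_derivative_transform_within_open[OF has_derivative_id V])
       (use hom in \<open>auto simp: homeomorphism_def\<close>)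
  ultimately have "(*v) A \<circ> (*v) M = id" by (rule has_derivative_unique)
  then have AM: "A ** M = mat 1"
    by (simp add: matrix_eq fun_eq_iff flip: matrix_vector_mul_assoc)
  obtain k where k: "k > 0" "onorm (((*v) M) ^^ k) < 1 / 2"
    using small_onorm_iterate[OF ev AM, of "1 / 2"] by auto
  have G'M: "(G has_derivative (*v) M) (at x0)" using G' by (simp add: M)
  obtain r1 C where r1: "0 < r1" "r1 < r" and C: "C > 0"
    and inV: "\<And>x j. x \<in> ball x0 r1 \<Longrightarrow> (G ^^ j) x \<in> V"
    and decay: "\<And>x j. x \<in> ball x0 r1 \<Longrightarrow> dist ((G ^^ j) x) x0 \<le> C * (1 / 2) ^ (j div k)"
    using orbit_decay_if_iterate_contracts[OF G'M fixed k V \<open>r > 0\<close>] by metis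
  have "orbit_set G x1 \<subseteq> V \<and> has_box_dim (orbit_set G x1) 0" if x1: "x1 \<in> ball x0 r1" for x1
    unfolding orbit_set_def
  proof
    show "range (\<lambda>j. (G ^^ j) x1) \<subseteq> V" using inV[OF x1] by blast
    show "has_box_dim (range (\<lambda>j. (G ^^ j) x1)) 0"
      by (rule box_dim_range_geometric_decay[OF C _ _ k(1) decay[OF x1]]) simp_all
  qed
  with r1 show "\<exists>r1>0. r1 < r \<and>
      (\<forall>x1\<in>ball x0 r1. orbit_set G x1 \<subseteq> V \<and> has_box_dim (orbit_set G x1) 0)" by blast
qed

end
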